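(* The generating function of the polynomials $h_n(x,s;q)$ has the continued fraction expansion (as formal power series in $t$) $$\sum_{n\geq 0}h_n(x,s;q)t^n=\cfrac{1}{1-b_0t-\cfrac{\lambda_1t^2}{1-b_1t-\cfrac{\lambda_2t^2}{1-b_2t-\cfrac{\lambda_3t^2}{1-\ddots}}}},$$ with $$b_n=q^{n-1}(q^n+q^{n+1}-1)x\quad(n\ge 0),\qquad \lambda_n=-q^{n-1}[n]_q\bigl(s+q^{2n-2}(1-q)x^2\bigr)\quad(n\ge 1).$$
   Context: $x,s,q$ are indeterminates, and $[n]_q=\frac{1-q^n}{1-q}$. The Al-Salam-Chihara polynomials $P_n(z;a,b,c)$ are defined by $P_{-1}=0$, $P_0=1$ and $P_{n+1}(z;a,b,c)=(z-aq^n)P_n(z;a,b,c)-(c+bq^{n-1})[n]_qP_{n-1}(z;a,b,c)$. The rescaled discrete $q$-Hermite polynomials II are $h_n(x,s;q):=P_n(0;-x,0,s)$. Equivalently, $h_{-1}=0$, $h_0=1$ and $h_{n+1}(x,s;q)=q^nx\,h_n(x,s;q)-[n]_q\,s\,h_{n-1}(x,s;q)$ for $n\ge0$. *)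

theory Defs
  imports "HOL-Computational_Algebra.Computational_Algebra"
begin

text \<open>
  The ground structure is the rational function field in the three independent indeterminates
  \<open>x\<close>, \<open>s\<close>, \<open>q\<close> over an arbitrary integral domain \<open>'k\<close>, namely the fraction field of
  \<open>'k[x][s][q]\<close>, with \<open>x\<close> the innermost and \<open>q\<close> the outermost variable.
\<close>

type_synonym 'k ratfun3 = "'k poly poly poly fract"

definition indet_x :: "'k::idom ratfun3"
  where "indet_x = to_fract [:[:[:0, 1:]:]:]"

definition indet_s :: "'k::idom ratfun3"
  where "indet_s = to_fract [:[:0, 1:]:]"

definition indet_q :: "'k::idom ratfun3"
  where "indet_q = to_fract [:0, 1:]"

definition qnum :: "'a::field \<Rightarrow> nat \<Rightarrow> 'a"
  where "qnum q n = (1 - q ^ n) / (1 - q)"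

text \<open>
  The usual three-term recurrence, started at \<open>P\<^sub>0 = 1\<close> and \<open>P\<^sub>1 = z - a\<close>; the latter is the
  recurrence at \<open>n = 0\<close>, where the second term vanishes because \<open>P\<^sub>-\<^sub>1 = 0\<close>.
\<close>

fun al_salam_chihara :: "'a::field \<Rightarrow> nat \<Rightarrow> 'a \<Rightarrow> 'a \<Rightarrow> 'a \<Rightarrow> 'a \<Rightarrow> 'a" where
  "al_salam_chihara q 0 z a b c = 1"
| "al_salam_chihara q (Suc 0) z a b c = z - a"
| "al_salam_chihara q (Suc (Suc n)) z a b c =
     (z - a * q ^ Suc n) * al_salam_chihara q (Suc n) z a b c
     - (c + b * q ^ n) * qnum q (Suc n) * al_salam_chihara q n z a b c"

definition q_hermite :: "nat \<Rightarrow> 'a::field \<Rightarrow> 'a \<Rightarrow> 'a \<Rightarrow> 'a"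
  where "q_hermite n x s q = al_salam_chihara q n 0 (- x) 0 s"

text \<open>
  \<open>jfraction_convergent b l k N\<close> is the finite continued fraction of depth \<open>N\<close> with top denominator
  \<open>1 - b\<^sub>k t - \<lambda>\<^sub>k\<^sub>+\<^sub>1 t\<^sup>2 / (\<dots>)\<close> and the remaining tail replaced by \<open>0\<close>. All
  denominators have constant term \<open>1\<close>, so the divisions are by units. The value of the infinite
  fraction is the limit over \<open>N\<close>, in the standard metric on formal power series, of the
  convergents with \<open>k = 0\<close>.
\<close>

fun jfraction_convergent :: "(nat \<Rightarrow> 'a::field) \<Rightarrow> (nat \<Rightarrow> 'a) \<Rightarrow> nat \<Rightarrow> nat \<Rightarrow> 'a fps" where
  "jfraction_convergent b l k 0 = 0"
| "jfraction_convergent b l k (Suc N) =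
     1 / (1 - fps_const (b k) * fps_X
            - fps_const (l (Suc k)) * fps_X ^ 2 * jfraction_convergent b l (Suc k) N)"

definition has_jfraction_expansion :: "'a::field fps \<Rightarrow> (nat \<Rightarrow> 'a) \<Rightarrow> (nat \<Rightarrow> 'a) \<Rightarrow> bool"
  where "has_jfraction_expansion f b l \<longleftrightarrow> (\<lambda>N. jfraction_convergent b l 0 N) \<longlonglongrightarrow> f"

end

theory Submission
  imports Defs
begin

text \<open>
  The proof is Euler's method of contiguous series. Let \<open>G\<^sub>-\<^sub>1 = 1\<close> and suppose that series
  \<open>G\<^sub>k\<close> with constant term \<open>1\<close> satisfy

    \<open>G\<^sub>k = G\<^sub>k\<^sub>-\<^sub>1 + b\<^sub>k t G\<^sub>k + \<lambda>\<^sub>k\<^sub>+\<^sub>1 t\<^sup>2 G\<^sub>k\<^sub>+\<^sub>1\<close>.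

  Dividing by \<open>G\<^sub>k\<close> shows that the quotients \<open>R\<^sub>k = G\<^sub>k / G\<^sub>k\<^sub>-\<^sub>1\<close> obey
  \<open>R\<^sub>k = 1 / (1 - b\<^sub>k t - \<lambda>\<^sub>k\<^sub>+\<^sub>1 t\<^sup>2 R\<^sub>k\<^sub>+\<^sub>1)\<close>, so that \<open>G\<^sub>0 = R\<^sub>0\<close> unrolls into the
  J-fraction; each level gains a factor \<open>t\<^sup>2\<close> of accuracy, which gives convergence
  (\<open>has_jfraction_expansion_if_contiguous\<close>). It remains to guess the \<open>G\<^sub>k\<close>. Here they are

    \<open>G\<^sub>k = (\<Sum>m. [m+k choose k]\<^sub>q h\<^sub>m(q\<^sup>k x, s; q) t\<^sup>m)\<close>,

  and \<open>G\<^sub>0\<close> is the generating function in question.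

  The contiguous relation (\<open>shifted_hermite_fps_rec\<close>) rests on two identities that compare
  the polynomials at \<open>z\<close> and at \<open>q z\<close>:

    \<open>h\<^sub>m\<^sub>+\<^sub>1(z) = h\<^sub>m\<^sub>+\<^sub>1(q z) + (1 - q\<^sup>m\<^sup>+\<^sup>1) z h\<^sub>m(q z)\<close>,

    \<open>(s + (1 - q) z\<^sup>2) h\<^sub>m(q z) = (1 - q) z h\<^sub>m\<^sub>+\<^sub>1(z) + s h\<^sub>m(z)\<close>.

  At \<open>z = q\<^sup>k x\<close> the factor on the left of the second one is exactly the bracket in
  \<open>\<lambda>\<^sub>k\<^sub>+\<^sub>1\<close>, so the \<open>\<lambda>\<close>-term of the relation can be expressed by polynomials at \<open>q\<^sup>k x\<close>
  alone. The first one, at \<open>z = q\<^sup>k\<^sup>-\<^sup>1 x\<close>, does the same for \<open>G\<^sub>k\<^sub>-\<^sub>1\<close>, and then the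
  coefficient of \<open>h\<^sub>m(q\<^sup>k x)\<close> that is left over is the one that \<open>b\<^sub>k\<close> supplies. The
  divisions by \<open>q\<close> in \<open>b\<^sub>0\<close> and by \<open>1 - q\<close> in \<open>[n]\<^sub>q\<close> are genuine ones, since the indeterminate
  \<open>q\<close> is neither \<open>0\<close> nor \<open>1\<close>.
\<close>

section \<open>Gaussian binomial coefficients\<close>

lemma one_minus_power_eq_qnum:
  assumes "q \<noteq> (1::'a::field)"
  shows "1 - q ^ n = (1 - q) * qnum q n"
  using assms by (simp add: qnum_def)

lemma qnum_add:
  assumes "q \<noteq> (1::'a::field)"
  shows "qnum q (m + n) = qnum q m + q ^ m * qnum q n"
  using assms by (simp add: qnum_def field_simps power_add)

lemma qnum_1 [simp]: "q \<noteq> (1::'a::field) \<Longrightarrow> qnum q (Suc 0) = 1"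
  by (simp add: qnum_def)

text \<open>
  The Gaussian binomial coefficient \<open>[m + k choose k]\<^sub>q\<close>, by the \<open>q\<close>-Pascal rule. Indexing by the
  two parts \<open>m\<close> and \<open>k\<close> of the top entry avoids truncated subtraction and lets \<open>m\<close> be the
  exponent of \<open>t\<close> in the series that follow.
\<close>
fun gauss_binom :: "'a::field \<Rightarrow> nat \<Rightarrow> nat \<Rightarrow> 'a" where
  "gauss_binom q 0 k = 1"
| "gauss_binom q (Suc m) 0 = 1"
| "gauss_binom q (Suc m) (Suc k) =
     gauss_binom q (Suc m) k + q ^ Suc k * gauss_binom q m (Suc k)"

lemma gauss_binom_0 [simp]: "gauss_binom q m 0 = 1"
  by (cases m) auto

text \<open>
  The absorption rule \<open>[k+1] [n choose k+1] = [n-k] [n choose k]\<close> at \<open>n = m+k+1\<close>. Both sides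
  are equal to \<open>[m+k+1] [m+k choose k]\<close>: expand either one by the Pascal rule, and the induction
  hypothesis turns its two parts into multiples of \<open>[m+k choose k]\<close> by \<open>[k+1] + q\<^sup>k\<^sup>+\<^sup>1 [m]\<close> and
  by \<open>[k] + q\<^sup>k [m+1]\<close>. Arguing without factorials keeps the rule valid when \<open>q\<close> is a root of unity.
\<close>
lemma qnum_mult_gauss_binom:
  assumes "q \<noteq> (1::'a::field)"
  shows "qnum q (Suc k) * gauss_binom q m (Suc k) = qnum q (Suc m) * gauss_binom q (Suc m) k"
proof (induction "m + k" arbitrary: m k rule: less_induct)
  case less
  have left: "qnum q (Suc k) * gauss_binom q m (Suc k) = qnum q (Suc (m + k)) * gauss_binom q m k"
  proof (cases m)
    case (Suc m')
    have "qnum q (Suc k) * gauss_binom q m (Suc k)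
        = qnum q (Suc k) * gauss_binom q m k
          + q ^ Suc k * (qnum q (Suc k) * gauss_binom q m' (Suc k))"
      unfolding Suc by (simp add: algebra_simps)
    also have "qnum q (Suc k) * gauss_binom q m' (Suc k) = qnum q m * gauss_binom q m k"
      using less[of m' k] Suc by simp
    also have "qnum q (Suc k) * gauss_binom q m k + q ^ Suc k * (qnum q m * gauss_binom q m k)
        = qnum q (Suc k + m) * gauss_binom q m k"
      unfolding qnum_add[OF assms] by (simp add: algebra_simps)
    finally show ?thesis by (simp add: add.commute)
  qed simp
  have right: "qnum q (Suc m) * gauss_binom q (Suc m) k = qnum q (Suc (m + k)) * gauss_binom q m k"
  proof (cases k)
    case (Suc k')
    have "qnum q (Suc m) * gauss_binom q (Suc m) k
        = qnum q (Suc m) * gauss_binom q (Suc m) k'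
          + q ^ k * (qnum q (Suc m) * gauss_binom q m k)"
      unfolding Suc by (simp add: algebra_simps)
    also have "qnum q (Suc m) * gauss_binom q (Suc m) k' = qnum q k * gauss_binom q m k"
      using less[of m k'] Suc by simp
    also have "qnum q k * gauss_binom q m k + q ^ k * (qnum q (Suc m) * gauss_binom q m k)
        = qnum q (k + Suc m) * gauss_binom q m k"
      unfolding qnum_add[OF assms] by (simp add: algebra_simps)
    finally show ?thesis by (simp add: add.commute)
  qed simp
  show ?case using left right by simp
qed

section \<open>Discrete \<open>q\<close>-Hermite polynomials at \<open>z\<close> and at \<open>q z\<close>\<close>

lemma q_hermite_0 [simp]: "q_hermite 0 x s q = 1"
  by (simp add: q_hermite_def)

lemma q_hermite_1 [simp]: "q_hermite (Suc 0) x s q = x"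
  by (simp add: q_hermite_def)

lemma q_hermite_rec:
  "q_hermite (Suc (Suc n)) x s q =
     q ^ Suc n * x * q_hermite (Suc n) x s q - qnum q (Suc n) * s * q_hermite n x s q"
  by (simp add: q_hermite_def algebra_simps)

text \<open>
  By induction along the three-term recurrence. After the induction hypotheses and
  the recurrence at \<open>q z\<close> have been used, what is left cancels because
  \<open>(1 - q\<^sup>n\<^sup>+\<^sup>2) [n+1] = [n+2] (1 - q\<^sup>n\<^sup>+\<^sup>1)\<close>.
\<close>
lemma q_hermite_qshift:
  assumes "q \<noteq> (1::'a::field)"
  shows "q_hermite (Suc m) z s q =
           q_hermite (Suc m) (q * z) s q + (1 - q ^ Suc m) * z * q_hermite m (q * z) s q"
proof (induction m rule: induct_nat_012)
  case 0
  show ?case by (simp add: algebra_simps)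
next
  case 1
  show ?case using assms by (simp add: q_hermite_rec algebra_simps power2_eq_square)
next
  case (ge2 n)
  define H where "H m = q_hermite m (q * z) s q" for m
  define Q where "Q = q ^ n"
  define A where "A = qnum q (Suc n)"
  define B where "B = qnum q (Suc (Suc n))"
  have H2: "H (Suc (Suc n)) = q * Q * (q * z) * H (Suc n) - A * s * H n"
    unfolding H_def A_def Q_def by (simp add: q_hermite_rec)
  have H3: "H (Suc (Suc (Suc n))) = q * (q * Q) * (q * z) * H (Suc (Suc n)) - B * s * H (Suc n)"
    unfolding H_def B_def Q_def by (simp add: q_hermite_rec[of "Suc n"])
  have AB: "(1 - q * (q * Q)) * A = B * (1 - q * Q)"
    using one_minus_power_eq_qnum[OF assms, of "Suc n"]
      one_minus_power_eq_qnum[OF assms, of "Suc (Suc n)"]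
    by (simp add: A_def B_def Q_def)
  have "q_hermite (Suc (Suc (Suc n))) z s q
      = q * (q * Q) * z * (H (Suc (Suc n)) + (1 - q * (q * Q)) * z * H (Suc n))
        - B * s * (H (Suc n) + (1 - q * Q) * z * H n)"
    unfolding q_hermite_rec[of "Suc n" z] ge2 by (simp add: H_def Q_def B_def)
  also have "\<dots> = H (Suc (Suc (Suc n))) + (1 - q * (q * (q * Q))) * z * H (Suc (Suc n))"
    unfolding H3 using AB H2 by algebra
  finally show ?case by (simp add: H_def Q_def)
qed

text \<open>
  Shift both polynomials on the right to \<open>q z\<close> and reduce by the recurrence: the contributions
  of \<open>h\<^sub>m\<^sub>-\<^sub>1(q z)\<close> cancel, since \<open>(1 - q) [m] = 1 - q\<^sup>m\<close>.
\<close>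
lemma q_hermite_lowering:
  assumes "q \<noteq> (1::'a::field)"
  shows "(s + (1 - q) * z ^ 2) * q_hermite m (q * z) s q =
           (1 - q) * z * q_hermite (Suc m) z s q + s * q_hermite m z s q"
proof (cases m)
  case 0
  then show ?thesis by (simp add: power2_eq_square algebra_simps)
next
  case (Suc n)
  define A where "A = qnum q (Suc n)"
  have A: "1 - q ^ Suc n = (1 - q) * A"
    unfolding A_def by (rule one_minus_power_eq_qnum[OF assms])
  show ?thesis
    unfolding Suc q_hermite_qshift[OF assms, of _ z]
    unfolding q_hermite_rec[of n "q * z"] A_def[symmetric] A
    by (simp add: algebra_simps power2_eq_square)
qed

section \<open>The contiguous series\<close>

definition shifted_hermite_fps :: "'a::field \<Rightarrow> 'a \<Rightarrow> 'a \<Rightarrow> nat \<Rightarrow> 'a fps" where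
  "shifted_hermite_fps x s q k = Abs_fps (\<lambda>m. gauss_binom q m k * q_hermite m (q ^ k * x) s q)"

text \<open>
  The \<open>\<lambda>\<^sub>k\<^sub>+\<^sub>1\<close>-term of the contiguous relation, rewritten at the argument \<open>y = q\<^sup>k x\<close>: absorption
  removes \<open>[k+1]\<close>, lowering removes the bracket, and the recurrence trades \<open>[m+1] s h\<^sub>m(y)\<close> for
  \<open>q\<^sup>m\<^sup>+\<^sup>1 y h\<^sub>m\<^sub>+\<^sub>1(y) - h\<^sub>m\<^sub>+\<^sub>2(y)\<close>.
\<close>
lemma shifted_hermite_lambda_term:
  assumes "q \<noteq> (1::'a::field)"
  shows "- (q ^ k) * qnum q (Suc k) * (s + q ^ (2 * k) * (1 - q) * x ^ 2)
           * (gauss_binom q m (Suc k) * q_hermite m (q ^ Suc k * x) s q)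
         = q ^ k * gauss_binom q (Suc m) k
             * (q_hermite (Suc (Suc m)) (q ^ k * x) s q
                - q ^ k * x * q_hermite (Suc m) (q ^ k * x) s q)"
proof -
  define y where "y = q ^ k * x"
  define G where "G = gauss_binom q (Suc m) k"
  define C where "C = qnum q (Suc m)"
  have pow: "1 - q ^ Suc m = (1 - q) * C"
    unfolding C_def by (rule one_minus_power_eq_qnum[OF assms])
  have "- (q ^ k) * qnum q (Suc k) * (s + q ^ (2 * k) * (1 - q) * x ^ 2)
           * (gauss_binom q m (Suc k) * q_hermite m (q ^ Suc k * x) s q)
      = - (q ^ k) * (qnum q (Suc k) * gauss_binom q m (Suc k))
          * ((s + (1 - q) * y ^ 2) * q_hermite m (q * y) s q)"
    unfolding y_def power_mult_distrib power_even_eq by (simp add: mult_ac)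
  also have "\<dots> = q ^ k * G
      * (- ((1 - q) * C * y * q_hermite (Suc m) y s q) - C * s * q_hermite m y s q)"
    unfolding qnum_mult_gauss_binom[OF assms] q_hermite_lowering[OF assms]
    by (simp add: G_def C_def algebra_simps)
  also have "- ((1 - q) * C * y * q_hermite (Suc m) y s q) - C * s * q_hermite m y s q
      = q_hermite (Suc (Suc m)) y s q - y * q_hermite (Suc m) y s q"
    unfolding q_hermite_rec C_def[symmetric] pow[symmetric] by (simp add: algebra_simps)
  finally show ?thesis by (simp add: y_def G_def)
qed

text \<open>
  With its Gaussian weight, the difference \<open>h\<^sub>m\<^sub>+\<^sub>1(q z) - h\<^sub>m\<^sub>+\<^sub>1(z)\<close> becomes a multiple of a
  coefficient of the next series, because absorption replaces \<open>1 - q\<^sup>m\<^sup>+\<^sup>1\<close> by \<open>1 - q\<^sup>k\<^sup>+\<^sup>1\<close>. This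
  factor, free of \<open>m\<close>, is what allows \<open>b\<close> to depend on \<open>k\<close> only.
\<close>
lemma gauss_binom_hermite_qshift:
  assumes "q \<noteq> (1::'a::field)"
  shows "gauss_binom q (Suc m) k * (q_hermite (Suc m) (q * z) s q - q_hermite (Suc m) z s q)
         = (q ^ Suc k - 1) * z * (gauss_binom q m (Suc k) * q_hermite m (q * z) s q)"
proof -
  have "gauss_binom q (Suc m) k * (q_hermite (Suc m) (q * z) s q - q_hermite (Suc m) z s q)
      = - ((1 - q) * (qnum q (Suc m) * gauss_binom q (Suc m) k) * z * q_hermite m (q * z) s q)"
    unfolding q_hermite_qshift[OF assms, of m z] one_minus_power_eq_qnum[OF assms]
    by (simp add: algebra_simps)
  also have "\<dots> = - (((1 - q) * qnum q (Suc k)) * gauss_binom q m (Suc k)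
      * z * q_hermite m (q * z) s q)"
    unfolding qnum_mult_gauss_binom[OF assms, symmetric] by (simp add: mult_ac)
  also have "\<dots> = (q ^ Suc k - 1) * z * (gauss_binom q m (Suc k) * q_hermite m (q * z) s q)"
    unfolding one_minus_power_eq_qnum[OF assms, symmetric] by (simp add: algebra_simps)
  finally show ?thesis .
qed

text \<open>
  With \<open>y = q\<^sup>k x\<close>, every term of the relation is a combination of \<open>h\<^sub>m\<^sub>+\<^sub>1(y)\<close> and \<open>h\<^sub>m(y)\<close>, and
  the two coefficients can be compared separately. That of \<open>h\<^sub>m\<^sub>+\<^sub>1(y)\<close> is the \<open>q\<close>-Pascal rule; that of
  \<open>h\<^sub>m(y)\<close> is the formula for \<open>b\<^sub>k\<close>. Everything is multiplied by \<open>q\<close> to clear the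
  denominators in \<open>b\<^sub>k = q\<^sup>-\<^sup>1 (q\<^sup>k + q\<^sup>k\<^sup>+\<^sup>1 - 1) y\<close> and in the argument \<open>y / q\<close> of \<open>G\<^sub>k\<^sub>-\<^sub>1\<close>.
\<close>
lemma shifted_hermite_fps_rec:
  fixes x s q :: "'a::field"
  assumes "q \<noteq> 0" "q \<noteq> 1"
    and b: "\<And>n. b n = q powi (int n - 1) * (q ^ n + q ^ (n + 1) - 1) * x"
    and l: "\<And>n. n \<ge> 1 \<Longrightarrow>
              l n = - (q ^ (n - 1)) * qnum q n * (s + q ^ (2 * n - 2) * (1 - q) * x ^ 2)"
  shows "shifted_hermite_fps x s q k =
           (case k of 0 \<Rightarrow> 1 | Suc j \<Rightarrow> shifted_hermite_fps x s q j)
           + fps_const (b k) * fps_X * shifted_hermite_fps x s q k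
           + fps_const (l (Suc k)) * fps_X ^ 2 * shifted_hermite_fps x s q (Suc k)"
    (is "?G k = ?P + _ + _")
proof (rule fps_ext)
  fix n
  define y where "y = q ^ k * x"
  define h where "h m = q_hermite m y s q" for m
  define g where "g m = gauss_binom q m k" for m
  have G: "?G k $ m = g m * h m" for m
    by (simp add: shifted_hermite_fps_def g_def h_def y_def)
  have qb: "q * b k = (q ^ k + q * q ^ k - 1) * y"
    using \<open>q \<noteq> 0\<close> by (simp add: b y_def power_int_diff)
  \<comment> \<open>At \<open>m = 0\<close> the left side has no contribution, in accordance with \<open>h\<^sub>1(y) = y h\<^sub>0(y)\<close>.\<close>
  have coeff_l: "(fps_const (l (Suc k)) * fps_X ^ 2 * ?G (Suc k)) $ Suc m
      = q ^ k * g m * (h (Suc m) - y * h m)" for m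
  proof (cases m)
    case 0
    then show ?thesis by (simp add: h_def mult.assoc fps_X_power_mult_nth)
  next
    case (Suc m')
    then show ?thesis
      using shifted_hermite_lambda_term[OF \<open>q \<noteq> 1\<close>, of k s x m']
      by (simp add: l mult.assoc fps_X_power_mult_nth shifted_hermite_fps_def h_def g_def y_def)
  qed
  \<comment> \<open>At \<open>k = 0\<close> the right side vanishes like the left one, because \<open>q\<^sup>k = 1\<close> and \<open>g = 1\<close>.\<close>
  have coeff_P: "q * ?P $ Suc m = q * (g (Suc m) * h (Suc m))
      - (q ^ k - 1) * y * g m * h m - q * (q ^ k * g m * h (Suc m))" for m
  proof (cases k)
    case 0
    then show ?thesis by (simp add: g_def)
  next
    case (Suc j)
    define z where "z = q ^ j * x"
    have y: "y = q * z" by (simp add: y_def z_def Suc)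
    have "?P $ Suc m = gauss_binom q (Suc m) j * q_hermite (Suc m) z s q"
      by (simp add: Suc shifted_hermite_fps_def z_def)
    also have "\<dots> = gauss_binom q (Suc m) j * h (Suc m) - (q ^ k - 1) * z * (g m * h m)"
      using gauss_binom_hermite_qshift[OF \<open>q \<noteq> 1\<close>, of m j z s] by (simp add: h_def g_def y Suc algebra_simps)
    finally have "q * ?P $ Suc m
        = q * (gauss_binom q (Suc m) j * h (Suc m) - (q ^ k - 1) * z * (g m * h m))"
      by (rule arg_cong)
    also have "\<dots> = q * (g (Suc m) * h (Suc m))
        - (q ^ k - 1) * y * g m * h m - q * (q ^ k * g m * h (Suc m))"
      by (simp add: g_def Suc y algebra_simps)
    finally show ?thesis .
  qed
  show "?G k $ n = (?P + fps_const (b k) * fps_X * ?G k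
      + fps_const (l (Suc k)) * fps_X ^ 2 * ?G (Suc k)) $ n"
  proof (cases n)
    case 0
    have "?P $ 0 = 1" by (simp add: shifted_hermite_fps_def split: nat.split)
    then show ?thesis
      using 0 by (simp add: G g_def h_def mult.assoc fps_X_power_mult_nth)
  next
    case (Suc m)
    have "(fps_const (b k) * fps_X * ?G k) $ Suc m = b k * (g m * h m)"
      by (simp add: G mult.assoc)
    then have "q * (?P + fps_const (b k) * fps_X * ?G k
        + fps_const (l (Suc k)) * fps_X ^ 2 * ?G (Suc k)) $ Suc m
        = q * (?P $ Suc m) + (q * b k) * (g m * h m) + q * (q ^ k * g m * (h (Suc m) - y * h m))"
      unfolding fps_add_nth coeff_l by (simp add: algebra_simps)
    also have "\<dots> = q * (g (Suc m) * h (Suc m))"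
      unfolding coeff_P qb by (simp add: algebra_simps)
    finally show ?thesis using \<open>q \<noteq> 0\<close> Suc G by simp
  qed
qed

section \<open>From contiguous series to a J-fraction\<close>

text \<open>
  If \<open>R = 1 / D(R')\<close> and \<open>J = 1 / D(J')\<close> with \<open>D(f) = 1 - b\<^sub>k t - \<lambda>\<^sub>k\<^sub>+\<^sub>1 t\<^sup>2 f\<close>, then
  \<open>R - J = R J (D(J') - D(R')) = R J \<lambda>\<^sub>k\<^sub>+\<^sub>1 t\<^sup>2 (R' - J')\<close>, so every level of the fraction
  contributes a factor \<open>t\<^sup>2\<close> to the error.
\<close>
lemma X_power_dvd_diff_convergent:
  fixes b l :: "nat \<Rightarrow> 'a::field"
  assumes R: "\<And>k. R k * (1 - fps_const (b k) * fps_X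
                           - fps_const (l (Suc k)) * fps_X ^ 2 * R (Suc k)) = 1"
  shows "fps_X ^ (2 * N) dvd R k - jfraction_convergent b l k N"
proof (induction N arbitrary: k)
  case (Suc N)
  define D where "D f = 1 - fps_const (b k) * fps_X - fps_const (l (Suc k)) * fps_X ^ 2 * f" for f
  define J where "J = jfraction_convergent b l k (Suc N)"
  define J' where "J' = jfraction_convergent b l (Suc k) N"
  have "D J' $ 0 \<noteq> 0" by (simp add: D_def)
  then have J: "J * D J' = 1"
    by (simp add: J_def J'_def D_def fps_divide_unit inverse_mult_eq_1)
  have "R k * D (R (Suc k)) = 1" using R[of k] by (simp add: D_def)
  with J have "R k - J = R k * J * (D J' - D (R (Suc k)))"
    by algebra
  also have "\<dots> = R k * J * fps_const (l (Suc k)) * (fps_X ^ 2 * (R (Suc k) - J'))"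
    by (simp add: D_def algebra_simps)
  finally have "R k - J = R k * J * fps_const (l (Suc k)) * (fps_X ^ 2 * (R (Suc k) - J'))" .
  moreover have "fps_X ^ (2 * Suc N) dvd fps_X ^ 2 * (R (Suc k) - J')"
    using Suc.IH[of "Suc k"] by (simp add: J'_def power_add mult_dvd_mono power2_eq_square mult.assoc)
  ultimately show ?case unfolding J_def by (metis dvd_mult)
qed simp

text \<open>
  Euler's method. The \<open>G\<^sub>k\<close> are units because of their constant terms, and the quotients of
  successive ones are the tails of the fraction; the error of the convergents is then divisible by
  ever higher powers of \<open>t\<close>, so each coefficient is eventually constant.
\<close>
lemma has_jfraction_expansion_if_contiguous:
  fixes b l :: "nat \<Rightarrow> 'a::field"
  assumes G0: "\<And>k. G k $ 0 = 1"
    and G: "\<And>k. G k = (case k of 0 \<Rightarrow> 1 | Suc j \<Rightarrow> G j)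
              + fps_const (b k) * fps_X * G k + fps_const (l (Suc k)) * fps_X ^ 2 * G (Suc k)"
  shows "has_jfraction_expansion (G 0) b l"
proof -
  define P where "P k = (case k of 0 \<Rightarrow> 1 | Suc j \<Rightarrow> G j)" for k
  define R where "R k = G k * inverse (P k)" for k
  have P_unit: "P k * inverse (P k) = 1" for k
    by (rule inverse_mult_eq_1') (simp add: P_def G0 split: nat.split)
  have "R k * (1 - fps_const (b k) * fps_X - fps_const (l (Suc k)) * fps_X ^ 2 * R (Suc k)) = 1" for k
  proof -
    have "G k * inverse (G k) = 1" using P_unit[of "Suc k"] by (simp add: P_def)
    moreover have "R (Suc k) = G (Suc k) * inverse (G k)" by (simp add: R_def P_def)
    moreover have "G k = P k + fps_const (b k) * fps_X * G k
        + fps_const (l (Suc k)) * fps_X ^ 2 * G (Suc k)"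
      using G[of k] by (simp add: P_def)
    ultimately show ?thesis
      using P_unit[of k] unfolding R_def[of k] by algebra
  qed
  note dvd = X_power_dvd_diff_convergent[of R b l, OF this]
  have "R 0 = G 0" by (simp add: R_def P_def)
  have "(\<lambda>N. jfraction_convergent b l 0 N) \<longlonglongrightarrow> G 0"
  proof (rule tendsto_fpsI)
    fix n
    show "\<forall>\<^sub>F N in sequentially. jfraction_convergent b l 0 N $ n = G 0 $ n"
    proof (rule eventually_sequentiallyI[of "Suc n"])
      fix N assume "Suc n \<le> N"
      obtain c where "R 0 - jfraction_convergent b l 0 N = fps_X ^ (2 * N) * c"
        using dvd[of N 0] by (elim dvdE)
      then have "(G 0 - jfraction_convergent b l 0 N) $ n = 0"
        using \<open>Suc n \<le> N\<close> \<open>R 0 = G 0\<close> by (simp add: fps_X_power_mult_nth)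
      then show "jfraction_convergent b l 0 N $ n = G 0 $ n" by simp
    qed
  qed
  then show ?thesis by (simp add: has_jfraction_expansion_def)
qed

section \<open>The expansion\<close>

theorem theorem6:
  fixes x s q :: "'k::idom ratfun3"
    and b l :: "nat \<Rightarrow> 'k ratfun3"
  assumes "x = indet_x" and "s = indet_s" and "q = indet_q"
    and "\<And>n. b n = q powi (int n - 1) * (q ^ n + q ^ (n + 1) - 1) * x"
    and "\<And>n. n \<ge> 1 \<Longrightarrow>
           l n = - (q ^ (n - 1)) * qnum q n * (s + q ^ (2 * n - 2) * (1 - q) * x ^ 2)"
  shows "has_jfraction_expansion (Abs_fps (\<lambda>n. q_hermite n x s q)) b l"
proof -
  have "q \<noteq> 0" unfolding assms(3) indet_q_def by simp
  have "q \<noteq> 1"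
  proof
    assume "q = 1"
    then have "to_fract [:0, 1 :: 'k poly poly:] = to_fract 1"
      unfolding assms(3) indet_q_def by simp
    then show False unfolding to_fract_eq_iff by (simp add: one_pCons)
  qed
  have "has_jfraction_expansion (shifted_hermite_fps x s q 0) b l"
  proof (rule has_jfraction_expansion_if_contiguous)
    show "shifted_hermite_fps x s q k $ 0 = 1" for k
      by (simp add: shifted_hermite_fps_def)
  qed (rule shifted_hermite_fps_rec[OF \<open>q \<noteq> 0\<close> \<open>q \<noteq> 1\<close> assms(4,5)])
  then show ?thesis by (simp add: shifted_hermite_fps_def)
qed

end
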